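(* Let $\Omega\subseteq\mathbb{R}^N$ be a region, let $M\subseteq\Omega$ be a closed set of Lebesgue measure zero, and let $V:\Omega\setminus M\to\mathbb{C}$ be continuous and bounded. For $h>0$ let $H_h:=-h^2\Delta+V$ act in $L^2(\Omega)$ with Dirichlet boundary conditions. Then for every $\lambda\in\Phi(V)$, $$\|(H_h-\lambda)^{-1}\|\to\infty\qquad\text{as } h\to 0.$$
   Context: A region in $\mathbb{R}^N$ ($N\ge 1$) is a non-empty connected open set; it may be unbounded. $H_h$ is the operator sum $H_{h,0}+V$, where $H_{h,0}=-h^2\Delta$ is the self-adjoint Dirichlet Laplacian on $L^2(\Omega)$ multiplied by $h^2$ (the self-adjoint operator associated with the closed form $f\mapsto h^2\int_\Omega|\nabla f|^2\,dx$ on $W_0^{1,2}(\Omega)$), and $V\in L^\infty(\Omega)$ acts as a bounded multiplication operator (its values on the null set $M$ are irrelevant and may be undefined); $\mathrm{Dom}(H_h)=\mathrm{Dom}(H_{h,0})$. Define $\mathrm{Ran}(V):=\{V(x):x\in\Omega\setminus M\}$ and $$\Phi(V):=\overline{\mathrm{Ran}(V)}+[0,\infty)=\{z+t: z\in\overline{\mathrm{Ran}(V)},\ t\ge 0\}\subseteq\mathbb{C}.$$ Convention: $\|(H_h-\lambda)^{-1}\|:=\infty$ if $\lambda\in\mathrm{Spec}(H_h)$; otherwise it is the operator norm on $L^2(\Omega)$. *)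

theory Defs
  imports "HOL-Analysis.Analysis"
begin

definition region :: "'a::euclidean_space set \<Rightarrow> bool" where
  "region \<Omega> \<longleftrightarrow> open \<Omega> \<and> connected \<Omega> \<and> \<Omega> \<noteq> {}"

text \<open>
  Elements of \<open>L\<^sup>2(\<Omega>)\<close> are represented by functions on the whole space whose values outside
  \<open>\<Omega>\<close> are irrelevant; no quotient is formed, so equality in \<open>L\<^sup>2(\<Omega>)\<close> is equality almost everywhere
  on \<open>\<Omega>\<close>.
\<close>

definition L2 :: "'a::euclidean_space set \<Rightarrow> ('a \<Rightarrow> complex) set" where
  "L2 \<Omega> = {f. f \<in> borel_measurable (lebesgue_on \<Omega>) \<and>
              integrable (lebesgue_on \<Omega>) (\<lambda>x. (cmod (f x))\<^sup>2)}"

definition L2_inner :: "'a::euclidean_space set \<Rightarrow> ('a \<Rightarrow> complex) \<Rightarrow> ('a \<Rightarrow> complex) \<Rightarrow> complex" where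
  "L2_inner \<Omega> f g = (LINT x|lebesgue_on \<Omega>. f x * cnj (g x))"

definition L2_nrm :: "'a::euclidean_space set \<Rightarrow> ('a \<Rightarrow> complex) \<Rightarrow> real" where
  "L2_nrm \<Omega> f = sqrt (LINT x|lebesgue_on \<Omega>. (cmod (f x))\<^sup>2)"

definition partial_deriv :: "'a::euclidean_space \<Rightarrow> ('a \<Rightarrow> complex) \<Rightarrow> 'a \<Rightarrow> complex" where
  "partial_deriv b f x = frechet_derivative f (at x) b"

fun C_k :: "nat \<Rightarrow> ('a::euclidean_space \<Rightarrow> complex) \<Rightarrow> bool" where
  "C_k 0 f \<longleftrightarrow> continuous_on UNIV f"
| "C_k (Suc k) f \<longleftrightarrow> (\<forall>x. f differentiable (at x)) \<and> (\<forall>b\<in>Basis. C_k k (partial_deriv b f))"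

text \<open>\<open>C\<^sub>c\<^sup>\<infinity>(\<Omega>)\<close>, each function being extended by zero to the whole space.\<close>

definition test_functions :: "'a::euclidean_space set \<Rightarrow> ('a \<Rightarrow> complex) set" where
  "test_functions \<Omega> = {\<phi>. (\<forall>k. C_k k \<phi>) \<and>
     compact (closure {x. \<phi> x \<noteq> 0}) \<and> closure {x. \<phi> x \<noteq> 0} \<subseteq> \<Omega>}"

definition is_weak_deriv ::
    "'a::euclidean_space set \<Rightarrow> 'a \<Rightarrow> ('a \<Rightarrow> complex) \<Rightarrow> ('a \<Rightarrow> complex) \<Rightarrow> bool" where
  "is_weak_deriv \<Omega> b f g \<longleftrightarrow> (\<forall>\<phi>\<in>test_functions \<Omega>.
     (LINT x|lebesgue_on \<Omega>. f x * partial_deriv b \<phi> x) = - (LINT x|lebesgue_on \<Omega>. g x * \<phi> x))"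

definition W12 :: "'a::euclidean_space set \<Rightarrow> ('a \<Rightarrow> complex) set" where
  "W12 \<Omega> = {f \<in> L2 \<Omega>. \<forall>b\<in>Basis. \<exists>g\<in>L2 \<Omega>. is_weak_deriv \<Omega> b f g}"

text \<open>A representative of the weak derivative, which is unique up to null sets; meaningful for
  \<open>f \<in> W12 \<Omega>\<close>.\<close>

definition weak_deriv :: "'a::euclidean_space set \<Rightarrow> 'a \<Rightarrow> ('a \<Rightarrow> complex) \<Rightarrow> 'a \<Rightarrow> complex" where
  "weak_deriv \<Omega> b f = (SOME g. g \<in> L2 \<Omega> \<and> is_weak_deriv \<Omega> b f g)"

definition W12_nrm :: "'a::euclidean_space set \<Rightarrow> ('a \<Rightarrow> complex) \<Rightarrow> real" where
  "W12_nrm \<Omega> f = sqrt ((L2_nrm \<Omega> f)\<^sup>2 + (\<Sum>b\<in>Basis. (L2_nrm \<Omega> (weak_deriv \<Omega> b f))\<^sup>2))"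

definition W12_0 :: "'a::euclidean_space set \<Rightarrow> ('a \<Rightarrow> complex) set" where
  "W12_0 \<Omega> = {f \<in> W12 \<Omega>. \<exists>\<phi>. (\<forall>n::nat. \<phi> n \<in> test_functions \<Omega>) \<and>
     (\<lambda>n. W12_nrm \<Omega> (\<lambda>x. f x - \<phi> n x)) \<longlonglongrightarrow> 0}"

text \<open>
  A linear operator \<open>A\<close> in \<open>L\<^sup>2(\<Omega>)\<close> is given by its graph: \<open>(u, f) \<in> A\<close> means that
  \<open>u \<in> Dom(A)\<close> and \<open>A u = f\<close>. All graphs below are closed under almost everywhere equality on \<open>\<Omega>\<close>
  in both components.
\<close>

type_synonym 'a L2_op = "(('a \<Rightarrow> complex) \<times> ('a \<Rightarrow> complex)) set"

text \<open>The operator associated with a sesquilinear form \<open>q\<close> with form domain \<open>D\<close>.\<close>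

definition form_op :: "'a::euclidean_space set \<Rightarrow> ('a \<Rightarrow> complex) set \<Rightarrow>
    (('a \<Rightarrow> complex) \<Rightarrow> ('a \<Rightarrow> complex) \<Rightarrow> complex) \<Rightarrow> 'a L2_op" where
  "form_op \<Omega> D q = {(u, f). u \<in> D \<and> f \<in> L2 \<Omega> \<and> (\<forall>v\<in>D. q u v = L2_inner \<Omega> f v)}"

definition dirichlet_form ::
    "'a::euclidean_space set \<Rightarrow> ('a \<Rightarrow> complex) \<Rightarrow> ('a \<Rightarrow> complex) \<Rightarrow> complex" where
  "dirichlet_form \<Omega> u v = (\<Sum>b\<in>Basis. L2_inner \<Omega> (weak_deriv \<Omega> b u) (weak_deriv \<Omega> b v))"

definition dirichlet_op :: "'a::euclidean_space set \<Rightarrow> real \<Rightarrow> 'a L2_op" where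
  "dirichlet_op \<Omega> h =
     form_op \<Omega> (W12_0 \<Omega>) (\<lambda>u v. complex_of_real (h\<^sup>2) * dirichlet_form \<Omega> u v)"

text \<open>The sum of \<open>A\<close> and multiplication by \<open>W\<close>, with the domain of \<open>A\<close>; meaningful for \<open>W\<close>
  measurable and essentially bounded on \<open>\<Omega>\<close>, in which case values of \<open>W\<close> on a null set do not
  affect the result if \<open>A\<close> is closed under almost everywhere equality.\<close>

definition add_mult :: "'a L2_op \<Rightarrow> ('a \<Rightarrow> complex) \<Rightarrow> 'a L2_op" where
  "add_mult A W = {(u, \<lambda>x. f x + W x * u x) | u f. (u, f) \<in> A}"

definition schroedinger_op ::
    "'a::euclidean_space set \<Rightarrow> ('a \<Rightarrow> complex) \<Rightarrow> real \<Rightarrow> 'a L2_op" where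
  "schroedinger_op \<Omega> V h = add_mult (dirichlet_op \<Omega> h) V"

definition shift_op :: "'a L2_op \<Rightarrow> complex \<Rightarrow> 'a L2_op" where
  "shift_op A lam = add_mult A (\<lambda>_. - lam)"

definition boundedly_invertible :: "'a::euclidean_space set \<Rightarrow> 'a L2_op \<Rightarrow> bool" where
  "boundedly_invertible \<Omega> B \<longleftrightarrow>
     (\<forall>f\<in>L2 \<Omega>. \<exists>u. (u, f) \<in> B) \<and>
     (\<forall>(u, f)\<in>B. (AE x in lebesgue_on \<Omega>. f x = 0) \<longrightarrow> (AE x in lebesgue_on \<Omega>. u x = 0)) \<and>
     (\<exists>C. \<forall>(u, f)\<in>B. L2_nrm \<Omega> u \<le> C * L2_nrm \<Omega> f)"

definition spectrum_op :: "'a::euclidean_space set \<Rightarrow> 'a L2_op \<Rightarrow> complex set" where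
  "spectrum_op \<Omega> A = {lam. \<not> boundedly_invertible \<Omega> (shift_op A lam)}"

definition op_norm :: "'a::euclidean_space set \<Rightarrow> 'a L2_op \<Rightarrow> ereal" where
  "op_norm \<Omega> B = Sup {ereal (L2_nrm \<Omega> f) | u f. (u, f) \<in> B \<and> L2_nrm \<Omega> u \<le> 1}"

definition resolvent_norm :: "'a::euclidean_space set \<Rightarrow> 'a L2_op \<Rightarrow> complex \<Rightarrow> ereal" where
  "resolvent_norm \<Omega> A lam =
     (if lam \<in> spectrum_op \<Omega> A then \<infinity> else op_norm \<Omega> ((shift_op A lam)\<inverse>))"

text \<open>The potential is a total function; its values on \<open>M\<close> are arbitrary and do not enter the
  following two sets.\<close>

definition Ran :: "'a set \<Rightarrow> 'a set \<Rightarrow> ('a \<Rightarrow> complex) \<Rightarrow> complex set" where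
  "Ran \<Omega> M V = V ` (\<Omega> - M)"

definition Phi :: "'a set \<Rightarrow> 'a set \<Rightarrow> ('a \<Rightarrow> complex) \<Rightarrow> complex set" where
  "Phi \<Omega> M V = {z + complex_of_real t | z t. z \<in> closure (Ran \<Omega> M V) \<and> 0 \<le> t}"

end

theory Submission
  imports Defs
begin

text \<open>
  Write \<open>\<lambda> = z + t\<close> with \<open>z\<close> in the closure of the range of \<open>V\<close> and \<open>t \<ge> 0\<close>. Near some point of the
  open set \<open>\<Omega> - M\<close> the potential is \<open>\<epsilon>\<close>-close to \<open>z\<close>. For a bump function \<open>\<phi>\<close> supported there, the
  function \<open>u(x) = exp(i (sqrt t / h) x\<^sub>b) \<phi>(x)\<close> satisfies \<open>\<parallel>(H\<^sub>h - \<lambda>)u\<parallel> \<le> C (\<epsilon> \<parallel>u\<parallel> + h)\<close>, so the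
  resolvent norm exceeds every bound as \<open>h \<rightarrow> 0\<close>. That \<open>u\<close> lies in the domain and that \<open>H\<^sub>h u\<close> is given
  by classical derivatives requires the uniqueness of weak derivatives and integration by parts for
  test functions.
\<close>

section \<open>Functions of class \<open>C\<^sup>k\<close>, plane waves and bump functions\<close>

text \<open>The recursion of \<open>C_k\<close> drops the function itself after one differentiation,
  so monotonicity in \<open>k\<close> needs its own induction; its base is that differentiable
  functions are continuous. The product rule, where undifferentiated factors reappear, relies on
  it.\<close>

lemma C_k_Suc_imp: "C_k (Suc k) f \<Longrightarrow> C_k k f"
proof (induction k arbitrary: f)
  case 0
  then show ?case
    by (auto intro!: continuous_at_imp_continuous_on differentiable_imp_continuous_within)
next
  case (Suc k)
  then show ?case by (metis C_k.simps(2))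
qed

lemma partial_deriv_eqI: "(f has_derivative f') (at x) \<Longrightarrow> partial_deriv b f x = f' b"
  unfolding partial_deriv_def using frechet_derivative_at by metis

lemma partial_deriv_add:
  assumes "f differentiable at x" "g differentiable at x"
  shows "partial_deriv b (\<lambda>x. f x + g x) x = partial_deriv b f x + partial_deriv b g x"
  using partial_deriv_eqI[OF has_derivative_add[OF assms[unfolded frechet_derivative_works]], of b]
  by (simp add: partial_deriv_def)

lemma partial_deriv_mult:
  assumes "f differentiable at x" "g differentiable at x"
  shows "partial_deriv b (\<lambda>x. f x * g x) x = f x * partial_deriv b g x + partial_deriv b f x * g x"
  using partial_deriv_eqI[OF has_derivative_mult[OF assms[unfolded frechet_derivative_works]], of b]
  by (simp add: partial_deriv_def)

lemma has_derivative_cnj_comp: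
  "(f has_derivative f') F \<Longrightarrow> ((\<lambda>x. cnj (f x)) has_derivative (\<lambda>x. cnj (f' x))) F"
  by (rule bounded_linear.has_derivative[OF bounded_linear_cnj])

lemma partial_deriv_cnj:
  assumes "f differentiable at x"
  shows "partial_deriv b (\<lambda>x. cnj (f x)) x = cnj (partial_deriv b f x)"
  using partial_deriv_eqI[OF has_derivative_cnj_comp[OF assms[unfolded frechet_derivative_works]], of b]
  by (simp add: partial_deriv_def)

lemma partial_deriv_const [simp]: "partial_deriv b (\<lambda>x. c) = (\<lambda>x. 0)"
  by (rule ext) (simp add: partial_deriv_eqI[OF has_derivative_const])

lemma C_k_const [simp]: "C_k k (\<lambda>x. c)"
  by (induction k arbitrary: c) auto

lemma C_k_cnj: "C_k k f \<Longrightarrow> C_k k (\<lambda>x. cnj (f x))"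
proof (induction k arbitrary: f)
  case 0
  then show ?case by (auto intro: continuous_intros)
next
  case (Suc k)
  then have "\<And>x. f differentiable at x" by auto
  moreover have "(\<lambda>x. cnj (f x)) differentiable at x" for x
    using \<open>f differentiable at x\<close> has_derivative_cnj_comp unfolding differentiable_def by blast
  moreover have "partial_deriv b (\<lambda>x. cnj (f x)) = (\<lambda>x. cnj (partial_deriv b f x))" for b
    by (intro ext partial_deriv_cnj) fact
  ultimately show ?case using Suc by simp
qed

lemma C_k_add: "C_k k f \<Longrightarrow> C_k k g \<Longrightarrow> C_k k (\<lambda>x. f x + g x)"
proof (induction k arbitrary: f g)
  case 0
  then show ?case by (auto intro: continuous_intros)
next
  case (Suc k)
  then have "partial_deriv b (\<lambda>x. f x + g x) = (\<lambda>x. partial_deriv b f x + partial_deriv b g x)" for b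
    by (intro ext partial_deriv_add) auto
  then show ?case using Suc by simp
qed

lemma C_k_mult: "C_k k f \<Longrightarrow> C_k k g \<Longrightarrow> C_k k (\<lambda>x. f x * g x)"
proof (induction k arbitrary: f g)
  case 0
  then show ?case by (auto intro: continuous_intros)
next
  case (Suc k)
  have "C_k k f" "C_k k g" using Suc.prems C_k_Suc_imp by blast+
  moreover have "partial_deriv b (\<lambda>x. f x * g x) =
      (\<lambda>x. f x * partial_deriv b g x + partial_deriv b f x * g x)" for b
    using Suc.prems by (intro ext partial_deriv_mult) auto
  ultimately show ?case using Suc by (simp add: C_k_add)
qed

lemma C_k_prod: "finite I \<Longrightarrow> (\<And>i. i \<in> I \<Longrightarrow> C_k k (f i)) \<Longrightarrow> C_k k (\<lambda>x. \<Prod>i\<in>I. f i x)"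
  by (induction I rule: finite_induct) (auto intro: C_k_mult)

section \<open>Plane waves and smooth bumps\<close>

definition plane_wave :: "real \<Rightarrow> 'a::euclidean_space \<Rightarrow> 'a \<Rightarrow> complex" where
  "plane_wave k b x = exp (\<i> * complex_of_real (k * (x \<bullet> b)))"

lemma has_derivative_plane_wave:
  "(plane_wave k b has_derivative (\<lambda>y. \<i> * complex_of_real (k * (y \<bullet> b)) * plane_wave k b x)) (at x)"
proof -
  have "((\<lambda>x. \<i> * complex_of_real (k * (x \<bullet> b))) has_derivative
      (\<lambda>y. \<i> * complex_of_real (k * (y \<bullet> b)))) (at x)"
    by (intro bounded_linear_imp_has_derivative bounded_linear_const_mult
        bounded_linear_compose[OF bounded_linear_of_real] bounded_linear_inner_left)
  from has_derivative_compose[OF this DERIV_exp[unfolded has_field_derivative_def]]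
  show ?thesis by (simp add: plane_wave_def[abs_def] mult.commute)
qed

lemma partial_deriv_plane_wave:
  "partial_deriv c (plane_wave k b) = (\<lambda>x. \<i> * complex_of_real (k * (c \<bullet> b)) * plane_wave k b x)"
  by (rule ext) (rule partial_deriv_eqI[OF has_derivative_plane_wave])

lemma C_k_plane_wave: "C_k n (plane_wave k b)"
proof (induction n)
  case 0
  show ?case unfolding C_k.simps
    by (intro continuous_at_imp_continuous_on ballI has_derivative_continuous[OF has_derivative_plane_wave])
next
  case (Suc n)
  show ?case
    unfolding C_k.simps partial_deriv_plane_wave
    by (intro conjI allI ballI C_k_mult C_k_const Suc differentiableI[OF has_derivative_plane_wave])
qed

lemma norm_plane_wave [simp]: "cmod (plane_wave k b x) = 1"
  by (simp add: plane_wave_def)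

text \<open>The classical flat function \<open>exp (- 1 / s)\<close>, glued to zero. The powers
  \<open>s ^ j\<close> are included because differentiation only raises \<open>j\<close>, so that
  the linear span of the family is closed under derivatives.\<close>

definition flat_exp :: "nat \<Rightarrow> real \<Rightarrow> real" where
  "flat_exp j s = (if 0 < s then exp (- 1 / s) / s ^ j else 0)"

text \<open>From the right, substituting \<open>y = 1 / s\<close> turns the claim into the decay of
  \<open>y ^ j / exp y\<close> at infinity; from the left the function is zero.\<close>

lemma flat_exp_tendsto_0: "(flat_exp j \<longlongrightarrow> 0) (at 0)"
proof -
  have r: "((\<lambda>s::real. exp (- 1 / s) / s ^ j) \<longlongrightarrow> 0) (at_right 0)"
  proof (rule Lim_transform_eventually)
    show "((\<lambda>s::real. inverse s ^ j / exp (inverse s)) \<longlongrightarrow> 0) (at_right 0)"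
      by (rule filterlim_compose[OF tendsto_power_div_exp_0 filterlim_inverse_at_top_right])
  qed (simp add: exp_minus field_simps)
  have "(flat_exp j \<longlongrightarrow> 0) (at_right 0)"
    by (rule Lim_transform_eventually[OF r])
       (auto simp: flat_exp_def eventually_at_filter)
  moreover have "(flat_exp j \<longlongrightarrow> 0) (at_left 0)"
    by (rule Lim_transform_eventually[OF tendsto_const])
       (auto simp: flat_exp_def eventually_at_filter)
  ultimately show ?thesis by (rule filterlim_split_at_real[rotated])
qed

lemma flat_exp_deriv:
  "(flat_exp j has_real_derivative flat_exp (j + 2) s - real j * flat_exp (j + 1) s) (at s)"
proof (cases s "0::real" rule: linorder_cases)
  case less
  have "((\<lambda>_. 0) has_real_derivative 0) (at s)" by simp
  then have "(flat_exp j has_real_derivative 0) (at s)"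
    by (rule has_field_derivative_transform_within_open[of _ _ _ "{..<0}"])
       (use less in \<open>auto simp: flat_exp_def\<close>)
  then show ?thesis using less by (simp add: flat_exp_def)
next
  case equal
  \<comment> \<open>The difference quotient at 0 is again a member of the family, with index
    \<open>Suc j\<close>, so it tends to 0.\<close>
  have "((\<lambda>h. flat_exp j h / h) \<longlongrightarrow> 0) (at 0)"
    by (rule Lim_transform_eventually[OF flat_exp_tendsto_0[of "Suc j"]])
       (auto simp: flat_exp_def eventually_at_filter)
  then show ?thesis using equal by (simp add: DERIV_def flat_exp_def)
next
  case greater
  have "((\<lambda>s. exp (- 1 / s) / s ^ j) has_real_derivative
     flat_exp (j + 2) s - real j * flat_exp (j + 1) s) (at s)"
  \<comment> \<open>The power rule produces the exponent \<open>j - 1\<close>, truncated at zero;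
    the case split resolves it.\<close>
  proof (cases j)
    case 0
    then show ?thesis using greater
      by (auto intro!: derivative_eq_intros simp: flat_exp_def field_simps power2_eq_square)
  next
    case (Suc n)
    then show ?thesis using greater
      by (auto intro!: derivative_eq_intros simp: flat_exp_def field_simps power2_eq_square)
         (cases n; simp)
  qed
  then show ?thesis
    by (rule has_field_derivative_transform_within_open[of _ _ _ "{0<..}"])
       (use greater in \<open>auto simp: flat_exp_def\<close>)
qed

text \<open>Partial derivatives are constant multiples of combinations of the members
  \<open>j + 1\<close> and \<open>j + 2\<close>, which is why \<open>j\<close> stays arbitrary in
  the induction.\<close>

lemma C_k_flat_exp: "C_k k (\<lambda>x. complex_of_real (flat_exp j (x \<bullet> v + c)))"
proof (induction k arbitrary: j)
  case 0
  have "continuous_on UNIV (flat_exp j)"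
    using flat_exp_deriv by (meson DERIV_isCont continuous_at_imp_continuous_on)
  then show ?case
    by (auto intro!: continuous_intros continuous_on_compose2[of UNIV "flat_exp j"])
next
  case (Suc k)
  let ?f = "\<lambda>j x. complex_of_real (flat_exp j (x \<bullet> v + c))"
  have d: "(?f j has_derivative (\<lambda>y. complex_of_real (y \<bullet> v) *
      (?f (j + 2) x + complex_of_real (- real j) * ?f (j + 1) x))) (at x)" for x
  proof -
    have "((\<lambda>x. flat_exp j (x \<bullet> v + c)) has_derivative (\<lambda>y. (y \<bullet> v) *
        (flat_exp (j + 2) (x \<bullet> v + c) - real j * flat_exp (j + 1) (x \<bullet> v + c)))) (at x)"
    proof -
      have "((\<lambda>x. x \<bullet> v + c) has_derivative (\<lambda>y. y \<bullet> v)) (at x)"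
        by (auto intro!: derivative_eq_intros)
      from has_derivative_compose[OF this flat_exp_deriv[unfolded has_field_derivative_def]]
      show ?thesis by (simp add: mult.commute)
    qed
    from has_derivative_of_real[OF this] show ?thesis by simp
  qed
  then have "partial_deriv b (?f j) = (\<lambda>x. complex_of_real (b \<bullet> v) *
      (?f (j + 2) x + complex_of_real (- real j) * ?f (j + 1) x))" for b
    by (intro ext partial_deriv_eqI)
  moreover have "?f j differentiable at x" for x
    using d unfolding differentiable_def by blast
  ultimately show ?case
    using Suc.IH by (simp only: C_k.simps) (intro conjI allI ballI C_k_mult C_k_add C_k_const TrueI)
qed

text \<open>For each direction the two arguments are \<open>Suc n\<close> times the distances of
  \<open>x\<close> to the two opposite faces of the box, written as an inner product plus a constant
  to fit \<open>C_k_flat_exp\<close>. The factor \<open>Suc n\<close> steepens the bump towards the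
  indicator of the box.\<close>

definition box_bump :: "nat \<Rightarrow> 'a::euclidean_space \<Rightarrow> 'a \<Rightarrow> 'a \<Rightarrow> complex" where
  "box_bump n a c x = (\<Prod>b\<in>Basis.
     complex_of_real (flat_exp 0 (x \<bullet> (real (Suc n) *\<^sub>R b) + - (real (Suc n) * (a \<bullet> b)))) *
     complex_of_real (flat_exp 0 (x \<bullet> (- real (Suc n) *\<^sub>R b) + real (Suc n) * (c \<bullet> b))))"

lemma C_k_box_bump: "C_k k (box_bump n a c)"
  unfolding box_bump_def[abs_def] by (intro C_k_prod C_k_mult C_k_flat_exp) auto

lemma flat_exp_pos_iff: "flat_exp 0 s \<noteq> 0 \<longleftrightarrow> 0 < s"
  by (auto simp: flat_exp_def)

lemma box_bump_nonzero_iff: "box_bump n a c x \<noteq> 0 \<longleftrightarrow> x \<in> box a c"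
proof -
  have "0 < real (Suc n) * t - real (Suc n) * s \<longleftrightarrow> s < t" for s t :: real
    by (simp add: right_diff_distrib[symmetric] zero_less_mult_iff del: of_nat_Suc)
  from this[of "x \<bullet> b" "a \<bullet> b" for b] this[of "c \<bullet> b" "x \<bullet> b" for b] show ?thesis
    by (auto simp add: box_bump_def flat_exp_pos_iff mem_box simp del: of_nat_Suc)
qed

lemma norm_box_bump_le: "cmod (box_bump n a c x) \<le> 1"
proof -
  have "\<bar>flat_exp 0 s\<bar> \<le> 1" for s by (simp add: flat_exp_def)
  then show ?thesis unfolding box_bump_def
    by (intro norm_prod_le[THEN order_trans] prod_le_1) (auto simp: norm_mult intro!: mult_le_one)
qed

text \<open>Inside the box every factor is the exponential of a quantity tending to 0; outside, all
  bumps vanish. With the uniform bound 1 this serves dominated convergence.\<close>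

lemma box_bump_tendsto: "(\<lambda>n. box_bump n a c x) \<longlonglongrightarrow> indicator (box a c) x"
proof (cases "x \<in> box a c")
  case True
  have lim: "(\<lambda>n. flat_exp 0 (real (Suc n) * s)) \<longlonglongrightarrow> 1" if "s > 0" for s
  proof -
    have "(\<lambda>n. exp (- (1 / real (Suc n)) / s)) \<longlonglongrightarrow> exp (- 0 / s)"
      by (intro tendsto_intros LIMSEQ_Suc[OF lim_1_over_n]) (use that in auto)
    then show ?thesis using that by (simp add: flat_exp_def)
  qed
  have "(\<lambda>n. \<Prod>b\<in>Basis. complex_of_real (flat_exp 0 (real (Suc n) * ((x - a) \<bullet> b))) *
     complex_of_real (flat_exp 0 (real (Suc n) * ((c - x) \<bullet> b))))
    \<longlonglongrightarrow> (\<Prod>b\<in>(Basis::'a set). complex_of_real 1 * complex_of_real 1)"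
    using True by (intro tendsto_prod tendsto_mult tendsto_of_real lim) (auto simp: mem_box inner_diff_left)
  then show ?thesis using True
    by (simp add: box_bump_def[abs_def] algebra_simps inner_diff_left del: of_nat_Suc)
next
  case False
  then have "box_bump n a c x = 0" for n using box_bump_nonzero_iff by blast
  then show ?thesis using False by simp
qed

section \<open>Test functions and integration by parts\<close>

definition supp :: "('a::topological_space \<Rightarrow> complex) \<Rightarrow> 'a set" where
  "supp f = closure {x. f x \<noteq> 0}"

lemma closed_supp [simp]: "closed (supp f)"
  by (simp add: supp_def)

lemma not_in_supp: "x \<notin> supp f \<Longrightarrow> f x = 0"
  using closure_subset[of "{x. f x \<noteq> 0}"] by (auto simp: supp_def)

lemma supp_minimal: "closed K \<Longrightarrow> (\<And>x. x \<notin> K \<Longrightarrow> f x = 0) \<Longrightarrow> supp f \<subseteq> K"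
  unfolding supp_def by (rule closure_minimal) auto

lemma test_functions_iff:
  "\<phi> \<in> test_functions \<Omega> \<longleftrightarrow> (\<forall>k. C_k k \<phi>) \<and> compact (supp \<phi>) \<and> supp \<phi> \<subseteq> \<Omega>"
  by (simp add: test_functions_def supp_def)

text \<open>The exact support need not be computed: it is closed and contained in the compact set
  \<open>K\<close>, hence compact.\<close>

lemma test_functionsI:
  assumes "\<And>k. C_k k \<phi>" "compact K" "K \<subseteq> \<Omega>" "\<And>x. x \<notin> K \<Longrightarrow> \<phi> x = 0"
  shows "\<phi> \<in> test_functions \<Omega>"
proof -
  have "supp \<phi> \<subseteq> K" using assms(2,4) by (intro supp_minimal compact_imp_closed)
  moreover from this have "compact (supp \<phi>)"
    using compact_Int_closed[OF assms(2) closed_supp] by (metis inf.absorb2)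
  ultimately show ?thesis using assms(1,3) by (auto simp: test_functions_iff)
qed

lemma compact_supp: "\<phi> \<in> test_functions \<Omega> \<Longrightarrow> compact (supp \<phi>)"
  and supp_subset: "\<phi> \<in> test_functions \<Omega> \<Longrightarrow> supp \<phi> \<subseteq> \<Omega>"
  by (auto simp: test_functions_iff)

lemma test_functions_C_k: "\<phi> \<in> test_functions \<Omega> \<Longrightarrow> C_k k \<phi>"
  by (simp add: test_functions_def)

lemma test_functions_differentiable: "\<phi> \<in> test_functions \<Omega> \<Longrightarrow> \<phi> differentiable at x"
  using test_functions_C_k[of \<phi> \<Omega> "Suc 0"] by simp

lemma test_functions_continuous: "\<phi> \<in> test_functions \<Omega> \<Longrightarrow> continuous_on A \<phi>"
  using test_functions_C_k[of \<phi> \<Omega> 0] continuous_on_subset by auto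

lemma test_functions_outside: "\<phi> \<in> test_functions \<Omega> \<Longrightarrow> x \<notin> \<Omega> \<Longrightarrow> \<phi> x = 0"
  using supp_subset not_in_supp by blast

text \<open>Differentiation does not enlarge the support, since the function is constantly zero on
  the open complement of it.\<close>

lemma partial_deriv_test_functions:
  assumes "\<phi> \<in> test_functions \<Omega>" "b \<in> Basis"
  shows "partial_deriv b \<phi> \<in> test_functions \<Omega>"
proof (rule test_functionsI[OF _ compact_supp supp_subset])
  show "C_k k (partial_deriv b \<phi>)" for k
    using test_functions_C_k[OF assms(1), of "Suc k"] assms(2) by simp
next
  fix x assume x: "x \<notin> supp \<phi>"
  have "((\<lambda>_. 0) has_derivative (\<lambda>_. 0)) (at x)" by simp
  then have "(\<phi> has_derivative (\<lambda>_. 0)) (at x)"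
    by (rule has_derivative_transform_within_open[of _ _ _ _ "- supp \<phi>"])
       (use x in \<open>auto simp: not_in_supp\<close>)
  then show "partial_deriv b \<phi> x = 0" by (rule partial_deriv_eqI)
qed (rule assms)+

lemma cnj_test_functions:
  assumes "\<phi> \<in> test_functions \<Omega>"
  shows "(\<lambda>x. cnj (\<phi> x)) \<in> test_functions \<Omega>"
  by (rule test_functionsI[OF C_k_cnj[OF test_functions_C_k[OF assms]]
        compact_supp[OF assms] supp_subset[OF assms]]) (simp add: not_in_supp)

text \<open>No support condition is put on \<open>f\<close>, so that plane waves and constants are
  admissible factors.\<close>

lemma mult_test_functions:
  assumes "\<And>k. C_k k f" "\<phi> \<in> test_functions \<Omega>"
  shows "(\<lambda>x. f x * \<phi> x) \<in> test_functions \<Omega>"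
  by (rule test_functionsI[OF C_k_mult[OF assms(1) test_functions_C_k[OF assms(2)]]
        compact_supp[OF assms(2)] supp_subset[OF assms(2)]]) (simp add: not_in_supp)

lemma add_test_functions:
  assumes "\<phi> \<in> test_functions \<Omega>" "\<psi> \<in> test_functions \<Omega>"
  shows "(\<lambda>x. \<phi> x + \<psi> x) \<in> test_functions \<Omega>"
proof (rule test_functionsI)
  show "C_k k (\<lambda>x. \<phi> x + \<psi> x)" for k
    by (intro C_k_add assms[THEN test_functions_C_k])
  show "compact (supp \<phi> \<union> supp \<psi>)" by (intro compact_Un assms[THEN compact_supp])
  show "supp \<phi> \<union> supp \<psi> \<subseteq> \<Omega>" by (intro Un_least assms[THEN supp_subset])
qed (simp add: not_in_supp)

lemma zero_test_functions: "(\<lambda>x. 0) \<in> test_functions \<Omega>"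
  by (simp add: test_functions_def)

lemma sum_test_functions:
  "finite I \<Longrightarrow> (\<And>i. i \<in> I \<Longrightarrow> \<phi> i \<in> test_functions \<Omega>) \<Longrightarrow>
    (\<lambda>x. \<Sum>i\<in>I. \<phi> i x) \<in> test_functions \<Omega>"
  by (induction I rule: finite_induct) (simp_all add: add_test_functions zero_test_functions)

lemma box_bump_test_functions: "cbox a c \<subseteq> \<Omega> \<Longrightarrow> box_bump n a c \<in> test_functions \<Omega>"
  using box_bump_nonzero_iff[of n a c] box_subset_cbox[of a c]
  by (intro test_functionsI[OF C_k_box_bump compact_cbox]) auto

section \<open>Integrals of test functions and integration by parts\<close>

lemma integrable_compact_support:
  fixes f :: "'a::euclidean_space \<Rightarrow> 'b::{banach, second_countable_topology}"
  assumes "compact K" "continuous_on K f" "\<And>x. x \<notin> K \<Longrightarrow> f x = 0"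
  shows "integrable lborel f"
proof -
  have "(\<lambda>x. indicator K x *\<^sub>R f x) = f" using assms(3) by (auto simp: indicator_def)
  then show ?thesis using borel_integrable_compact[OF assms(1,2)] by simp
qed

lemma test_functions_integrable:
  assumes "\<phi> \<in> test_functions \<Omega>" shows "integrable lborel \<phi>"
proof (rule integrable_compact_support)
  show "compact (supp \<phi>)" using assms by (rule compact_supp)
qed (use test_functions_continuous[OF assms] not_in_supp in auto)

lemma test_functions_bounded:
  assumes "\<phi> \<in> test_functions \<Omega>" obtains B where "0 \<le> B" "\<And>x. cmod (\<phi> x) \<le> B"
proof -
  have "compact (\<phi> ` supp \<phi>)"
    by (intro compact_continuous_image test_functions_continuous[OF assms] compact_supp[OF assms])
  then obtain B where B: "0 < B" "\<And>x. x \<in> supp \<phi> \<Longrightarrow> cmod (\<phi> x) \<le> B"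
    using compact_imp_bounded bounded_pos by (metis image_eqI)
  have "cmod (\<phi> x) \<le> B" for x
    using B not_in_supp[of x \<phi>] by (cases "x \<in> supp \<phi>") auto
  then show ?thesis using that[of B] B(1) by simp
qed

text \<open>Bridge between the measure used in the definitions and \<open>lborel\<close>, on which
  translation invariance is applied below.\<close>

lemma integral_lebesgue_on_eq_lborel:
  fixes f :: "'a::euclidean_space \<Rightarrow> 'b::{banach, second_countable_topology}"
  assumes "open \<Omega>" "f \<in> borel_measurable borel" "\<And>x. x \<notin> \<Omega> \<Longrightarrow> f x = 0"
  shows "integral\<^sup>L (lebesgue_on \<Omega>) f = integral\<^sup>L lborel f"
proof -
  have "(\<lambda>x. indicator \<Omega> x *\<^sub>R f x) = f" using assms(3) by (auto simp: indicator_def)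
  then show ?thesis using assms(1,2)
    by (subst integral_restrict_space) (auto simp: integral_completion)
qed

lemma test_functions_measurable: "\<phi> \<in> test_functions \<Omega> \<Longrightarrow> \<phi> \<in> borel_measurable borel"
  by (intro borel_measurable_continuous_onI test_functions_continuous)

lemma integral_test_function:
  assumes "open \<Omega>" "\<phi> \<in> test_functions \<Omega>"
  shows "integral\<^sup>L (lebesgue_on \<Omega>) \<phi> = integral\<^sup>L lborel \<phi>"
  using assms test_functions_outside
  by (intro integral_lebesgue_on_eq_lborel test_functions_measurable) auto

lemma test_functions_L2:
  assumes "open \<Omega>" "\<phi> \<in> test_functions \<Omega>" shows "\<phi> \<in> L2 \<Omega>"
proof -
  have "integrable lborel (\<lambda>x. (cmod (\<phi> x))\<^sup>2)"
    by (rule integrable_compact_support[OF compact_supp[OF assms(2)]])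
       (auto simp: not_in_supp intro!: continuous_intros test_functions_continuous[OF assms(2)])
  then have "integrable lebesgue (\<lambda>x. (cmod (\<phi> x))\<^sup>2)"
    by (subst integrable_completion) auto
  then have "integrable (lebesgue_on \<Omega>) (\<lambda>x. (cmod (\<phi> x))\<^sup>2)"
    using assms(1)
    by (subst integrable_restrict_space)
       (auto intro!: integrable_mult_indicator simp del: real_scaleR_def)
  moreover have "\<phi> \<in> borel_measurable (lebesgue_on \<Omega>)"
    using test_functions_measurable[OF assms(2)]
    by (intro measurable_restrict_space1 measurable_completion) auto
  ultimately show ?thesis by (simp add: L2_def)
qed

text \<open>By translation invariance the integrals of all difference quotients of \<open>\<phi>\<close> vanish.\<close>

lemma integral_partial_deriv_test_function:
  fixes \<phi> :: "'a::euclidean_space \<Rightarrow> complex"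
  assumes \<phi>: "\<phi> \<in> test_functions \<Omega>" and b: "b \<in> Basis"
  shows "integral\<^sup>L lborel (partial_deriv b \<phi>) = 0"
proof -
  define K where "K = supp \<phi>"
  \<comment> \<open>All translates of the support by \<open>- t b\<close> with \<open>t\<close> in
    [0, 1]. As the steps \<open>s n\<close> lie in (0, 1], this compact set contains the support of
    every difference quotient \<open>q n\<close>, and a multiple of its indicator can dominate
    them.\<close>
  define K' where "K' = (\<lambda>(y, t). y - t *\<^sub>R b) ` (K \<times> {0..1::real})"
  define s :: "nat \<Rightarrow> real" where "s n = 1 / real (Suc n)" for n
  define q where "q n x = (\<phi> (s n *\<^sub>R b + x) - \<phi> x) /\<^sub>R s n" for n x
  have s: "0 < s n" "s n \<le> 1" for n by (auto simp: s_def)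
  have K: "compact K" using \<phi> by (simp add: K_def compact_supp)
  then have K': "compact K'" unfolding K'_def
    by (intro compact_continuous_image compact_Times) (auto intro!: continuous_intros simp: case_prod_unfold)
  obtain B where B: "0 \<le> B" "\<And>x. cmod (partial_deriv b \<phi> x) \<le> B"
    using test_functions_bounded[OF partial_deriv_test_functions[OF assms]] by blast
  have line: "((\<lambda>t. \<phi> (t *\<^sub>R b + x)) has_derivative (\<lambda>r. r *\<^sub>R partial_deriv b \<phi> (t *\<^sub>R b + x))) (at t)" for t x
  proof -
    have "((\<lambda>t. t *\<^sub>R b + x) has_derivative (\<lambda>r. r *\<^sub>R b)) (at t)"
      by (auto intro!: derivative_eq_intros)
    from has_derivative_compose[OF this
        test_functions_differentiable[OF \<phi>, unfolded frechet_derivative_works]]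
    show ?thesis
      using linear_scale[OF linear_frechet_derivative[OF test_functions_differentiable[OF \<phi>]]]
      by (simp add: partial_deriv_def)
  qed
  have "(\<lambda>n. integral\<^sup>L lborel (q n)) \<longlonglongrightarrow> integral\<^sup>L lborel (partial_deriv b \<phi>)"
  proof (rule integral_dominated_convergence)
    show "partial_deriv b \<phi> \<in> borel_measurable lborel"
      using test_functions_measurable[OF partial_deriv_test_functions[OF assms]] by simp
    show "q n \<in> borel_measurable lborel" for n
      using test_functions_measurable[OF \<phi>] unfolding q_def by measurable
    show "integrable lborel (\<lambda>x. indicator K' x *\<^sub>R B)"
      by (rule borel_integrable_compact[OF K']) auto
    show "AE x in lborel. (\<lambda>n. q n x) \<longlonglongrightarrow> partial_deriv b \<phi> x"
    proof (rule AE_I2)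
      fix x
      have "((\<lambda>t. (\<phi> (t *\<^sub>R b + x) - \<phi> x) /\<^sub>R t) \<longlongrightarrow> partial_deriv b \<phi> x) (at 0)"
      proof -
        have "((\<lambda>t. norm (\<phi> (t *\<^sub>R b + x) - \<phi> x - t *\<^sub>R partial_deriv b \<phi> x) / norm t) \<longlongrightarrow> 0) (at 0)"
          using line[of x 0] by (simp add: has_derivative_at)
        then have "((\<lambda>t. norm ((\<phi> (t *\<^sub>R b + x) - \<phi> x) /\<^sub>R t - partial_deriv b \<phi> x)) \<longlongrightarrow> 0) (at 0)"
        proof (rule Lim_transform_eventually)
          have "norm (u - t *\<^sub>R v) / norm t = norm (u /\<^sub>R t - v)" if "t \<noteq> 0" for t :: real and u v :: complex
          proof -
            have "u /\<^sub>R t - v = (u - t *\<^sub>R v) /\<^sub>R t" using that by (simp add: scaleR_diff_right)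
            then show ?thesis by (simp add: divide_inverse_commute)
          qed
          then show "\<forall>\<^sub>F t in at 0. norm (\<phi> (t *\<^sub>R b + x) - \<phi> x - t *\<^sub>R partial_deriv b \<phi> x) / norm t =
              norm ((\<phi> (t *\<^sub>R b + x) - \<phi> x) /\<^sub>R t - partial_deriv b \<phi> x)"
            by (auto simp: eventually_at_filter)
        qed
        then show ?thesis by (rule LIM_zero_cancel[OF tendsto_norm_zero_cancel])
      qed
      moreover have "filterlim s (at 0) sequentially"
        unfolding s_def by (simp add: filterlim_at LIMSEQ_Suc[OF lim_1_over_n] del: of_nat_Suc)
      ultimately show "(\<lambda>n. q n x) \<longlonglongrightarrow> partial_deriv b \<phi> x"
        unfolding q_def by (rule filterlim_compose)
    qed
    show "AE x in lborel. norm (q n x) \<le> indicator K' x *\<^sub>R B" for n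
    proof (rule AE_I2)
      fix x
      show "norm (q n x) \<le> indicator K' x *\<^sub>R B"
      proof (cases "x \<in> K'")
        case True
        \<comment> \<open>Mean value inequality along the segment from \<open>x\<close> in direction
          \<open>b\<close>.\<close>
        have "norm (\<phi> (s n *\<^sub>R b + x) - \<phi> (0 *\<^sub>R b + x)) \<le> B * norm (s n - 0)"
        proof (rule differentiable_bound[of UNIV])
          show "onorm (\<lambda>r. r *\<^sub>R partial_deriv b \<phi> (t *\<^sub>R b + x)) \<le> B" for t
            using B by (intro onorm_le) (simp add: mult.commute[of B] mult_left_mono)
        qed (use line in auto)
        moreover have "norm (q n x) = norm (\<phi> (s n *\<^sub>R b + x) - \<phi> x) / s n"
          using s(1)[of n] by (simp add: q_def divide_inverse_commute)
        ultimately show ?thesis using True s[of n] by (simp add: pos_divide_le_eq)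
      next
        case False
        \<comment> \<open>Otherwise \<open>x\<close> would be in \<open>K'\<close>, with parameter
          \<open>t = 0\<close> or \<open>t = s n\<close> respectively.\<close>
        have "x \<notin> K" "s n *\<^sub>R b + x \<notin> K"
          using False s[of n] by (force simp: K'_def image_iff)+
        then have "q n x = 0"
          unfolding K_def q_def using not_in_supp[of _ \<phi>] by fastforce
        then show ?thesis using False by simp
      qed
    qed
  qed
  moreover have "integral\<^sup>L lborel (q n) = 0" for n
  proof -
    have i: "integrable lborel \<phi>" by (rule test_functions_integrable[OF \<phi>])
    then have i': "integrable (distr lborel borel ((+) (s n *\<^sub>R b))) \<phi>" by (simp add: lborel_distr_plus)
    have j: "integrable lborel (\<lambda>x. \<phi> (s n *\<^sub>R b + x))"
      using integrable_distr[OF _ i'] by simp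
    have "integral\<^sup>L lborel (\<lambda>x. \<phi> (s n *\<^sub>R b + x)) = integral\<^sup>L (distr lborel borel ((+) (s n *\<^sub>R b))) \<phi>"
      by (subst integral_distr) (use test_functions_measurable[OF \<phi>] in auto)
    then show ?thesis using i j by (simp add: q_def[abs_def] lborel_distr_plus)
  qed
  ultimately show ?thesis by (simp add: LIMSEQ_const_iff)
qed

text \<open>The product of \<open>u\<close> with a test function is itself a test function, so the
  integral of its derivative vanishes; the product rule splits that integral into the two
  sides.\<close>

lemma is_weak_deriv_partial_deriv:
  assumes "open \<Omega>" "u \<in> test_functions \<Omega>" "b \<in> Basis"
  shows "is_weak_deriv \<Omega> b u (partial_deriv b u)"
  unfolding is_weak_deriv_def
proof
  fix \<phi> assume \<phi>: "\<phi> \<in> test_functions \<Omega>"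
  note d = partial_deriv_test_functions[OF _ assms(3)]
  have 1: "(\<lambda>x. u x * partial_deriv b \<phi> x) \<in> test_functions \<Omega>"
    and 2: "(\<lambda>x. partial_deriv b u x * \<phi> x) \<in> test_functions \<Omega>"
    and 3: "(\<lambda>x. u x * \<phi> x) \<in> test_functions \<Omega>"
    using test_functions_C_k d \<phi> assms(2) by (blast intro: mult_test_functions)+
  have "0 = integral\<^sup>L lborel (partial_deriv b (\<lambda>x. u x * \<phi> x))"
    using integral_partial_deriv_test_function[OF 3 assms(3)] by simp
  also have "partial_deriv b (\<lambda>x. u x * \<phi> x) = (\<lambda>x. u x * partial_deriv b \<phi> x + partial_deriv b u x * \<phi> x)"
    using \<phi> assms(2) by (intro ext partial_deriv_mult test_functions_differentiable)
  also have "integral\<^sup>L lborel \<dots> = (LINT x|lborel. u x * partial_deriv b \<phi> x) + (LINT x|lborel. partial_deriv b u x * \<phi> x)"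
    using 1 2 by (intro Bochner_Integration.integral_add test_functions_integrable)
  finally show "(LINT x|lebesgue_on \<Omega>. u x * partial_deriv b \<phi> x) = - (LINT x|lebesgue_on \<Omega>. partial_deriv b u x * \<phi> x)"
    using 1 2 assms(1) by (simp add: integral_test_function eq_neg_iff_add_eq_0)
qed

section \<open>The fundamental lemma of the calculus of variations\<close>

text \<open>A countable cover by Borel sets of finite measure keeps its measures under
  completion.\<close>

lemma sigma_finite_lebesgue: "sigma_finite_measure lebesgue"
proof
  obtain A :: "'a set set" where "countable A" "A \<subseteq> sets lborel" "\<Union>A = space lborel"
      "\<forall>a\<in>A. emeasure lborel a \<noteq> \<infinity>"
    using lborel.sigma_finite_countable by blast
  then show "\<exists>A :: 'a set set. countable A \<and> A \<subseteq> sets lebesgue \<and> \<Union>A = space lebesgue \<and>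
      (\<forall>a\<in>A. emeasure lebesgue a \<noteq> \<infinity>)"
    by (intro exI[of _ A]) (auto simp: subset_eq)
qed

text \<open>A Dynkin argument: boxes are stable under intersection and generate the Borel sets, and
  the sets over which \<open>f\<close> integrates to zero are closed under complements and countable
  disjoint unions. A function whose integral over every measurable set is zero vanishes almost
  everywhere.\<close>

lemma AE_zero_if_integral_box_zero:
  fixes f :: "'a::euclidean_space \<Rightarrow> 'b::{banach, second_countable_topology}"
  assumes f: "integrable lebesgue f"
    and box: "\<And>a c. (LINT x:box a c|lebesgue. f x) = 0" and total: "integral\<^sup>L lebesgue f = 0"
  shows "AE x in lebesgue. f x = 0"
proof (rule sigma_finite_measure.density_zero[OF sigma_finite_lebesgue f])
  have si: "set_integrable lebesgue A f" if "A \<in> sets lebesgue" for A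
    using integrable_mult_indicator[OF that f] by (simp add: set_integrable_def)
  let ?G = "range (\<lambda>(a, b). box a b :: 'a set)"
  have borel: "sets borel = sigma_sets UNIV ?G"
    by (subst borel_eq_box) simp
  have zero: "(LINT x:A|lebesgue. f x) = 0" if "A \<in> sets borel" for A
  proof -
    have "Int_stable ?G" by (auto simp: Int_stable_def box_Int_box)
    moreover have "?G \<subseteq> Pow UNIV" by simp
    moreover have "A \<in> sigma_sets UNIV ?G" using that by (simp add: borel)
    ultimately show ?thesis
    proof (induction rule: sigma_sets_induct_disjoint)
      case (basic A)
      then show ?case using box by auto
    next
      case (compl A)
      then have A: "A \<in> sets borel" by (simp add: borel)
      \<comment> \<open>Complements are where the vanishing of the total integral enters.\<close>
      have "(LINT x:UNIV|lebesgue. f x) = (LINT x:(UNIV - A) \<union> A|lebesgue. f x)" by simp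
      also have "\<dots> = (LINT x:UNIV - A|lebesgue. f x) + (LINT x:A|lebesgue. f x)"
        using A by (intro set_integral_Un si) auto
      finally show ?case using compl total by (simp add: set_lebesgue_integral_def)
    next
      case (union A)
      then have A: "A i \<in> sets borel" for i by (auto simp: borel)
      then have "(LINT x:(\<Union>i. A i)|lebesgue. f x) = (\<Sum>i. (LINT x:(A i)|lebesgue. f x))"
        using union(1) by (intro lebesgue_integral_countable_add si) (auto simp: disjoint_family_on_def)
      then show ?case using union by simp
    qed (auto simp: set_lebesgue_integral_def)
  qed
  fix A :: "'a set" assume A: "A \<in> sets lebesgue"
  \<comment> \<open>A Lebesgue set differs from its Borel part by a null set only, so the integrals
    agree.\<close>
  let ?A = "main_part lborel A"
  have "AE x in lebesgue. x \<in> ?A \<longleftrightarrow> x \<in> A"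
    by (rule AE_completion[OF AE_in_main_part[OF A]])
  then have "(LINT x:A|lebesgue. f x) = (LINT x:?A|lebesgue. f x)"
    using si[OF A] si[of ?A] main_part_sets[OF A] unfolding set_lebesgue_integral_def set_integrable_def
    by (intro integral_cong_AE borel_measurable_integrable) (auto simp: indicator_def)
  then show "(LINT x:A|lebesgue. f x) = 0" using zero[of ?A] main_part_sets[OF A] by simp
qed

text \<open>A box has finite measure, so the pointwise bound \<open>t \<le> 1 + t\<^sup>2\<close>
  passes from square integrability to integrability.\<close>

lemma L2_integrable_on_box:
  assumes "open \<Omega>" "g \<in> L2 \<Omega>" "box p q \<subseteq> \<Omega>"
  shows "integrable lebesgue (\<lambda>x. indicator (box p q) x *\<^sub>R g x)"
proof (rule Bochner_Integration.integrable_bound)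
  have m: "(\<lambda>x. indicator \<Omega> x *\<^sub>R g x) \<in> borel_measurable lebesgue"
    and i: "integrable lebesgue (\<lambda>x. indicator \<Omega> x *\<^sub>R (cmod (g x))\<^sup>2)"
    using assms by (auto simp: L2_def integrable_restrict_space borel_measurable_restrict_space_iff)
  have [measurable]: "box p q \<in> sets lebesgue" by simp
  \<comment> \<open>Measurability of \<open>g\<close> is known only on \<Omega>; the indicator of
    \<Omega> inserted here is absorbed by that of the box.\<close>
  have "(\<lambda>x. indicator (box p q) x *\<^sub>R (indicator \<Omega> x *\<^sub>R g x)) \<in> borel_measurable lebesgue"
    using m by measurable
  also have "(\<lambda>x. indicator (box p q) x *\<^sub>R (indicator \<Omega> x *\<^sub>R g x)) = (\<lambda>x. indicator (box p q) x *\<^sub>R g x)"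
    using assms(3) by (intro ext) (auto simp: indicator_def)
  finally show "(\<lambda>x. indicator (box p q) x *\<^sub>R g x) \<in> borel_measurable lebesgue" .
  have "integrable lborel (indicat_real (box p q))"
    by (intro integrable_real_indicator emeasure_bounded_finite) auto
  then have "integrable lebesgue (indicat_real (box p q))" by (subst integrable_completion) auto
  then show "integrable lebesgue (\<lambda>x. indicator (box p q) x + indicator \<Omega> x *\<^sub>R (cmod (g x))\<^sup>2)"
    using i by (rule Bochner_Integration.integrable_add)
  show "AE x in lebesgue. norm (indicator (box p q) x *\<^sub>R g x) \<le>
      norm (indicator (box p q) x + indicator \<Omega> x *\<^sub>R (cmod (g x))\<^sup>2)"
  proof (rule AE_I2)
    fix x
    have "t \<le> 1 + t\<^sup>2" for t :: real
      using zero_le_power2[of "t - 1/2"] by (simp add: power2_eq_square algebra_simps)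
    then show "norm (indicator (box p q) x *\<^sub>R g x) \<le>
        norm (indicator (box p q) x + indicator \<Omega> x *\<^sub>R (cmod (g x))\<^sup>2)"
      using assms(3) by (auto simp: indicator_def abs_of_nonneg add_nonneg_nonneg)
  qed
qed

text \<open>Since the closed box lies in \<Omega>, the bumps of the box are test functions;
  \<open>g\<close> integrates to zero against each of them, and dominated convergence passes to the
  indicator.\<close>

lemma integral_box_eq_0_if_orthogonal:
  assumes \<Omega>: "open \<Omega>" and g: "g \<in> L2 \<Omega>" and pq: "cbox p q \<subseteq> \<Omega>"
    and orth: "\<And>\<phi>. \<phi> \<in> test_functions \<Omega> \<Longrightarrow> (LINT x|lebesgue_on \<Omega>. g x * \<phi> x) = 0"
  shows "(LINT x|lebesgue. indicator (box p q) x *\<^sub>R g x) = 0"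
proof -
  have sub: "box p q \<subseteq> \<Omega>" using pq box_subset_cbox by blast
  have i: "integrable lebesgue (\<lambda>x. indicator (box p q) x *\<^sub>R g x)"
    by (rule L2_integrable_on_box[OF \<Omega> g sub])
  let ?s = "\<lambda>n x. (indicator (box p q) x *\<^sub>R g x) * box_bump n p q x"
  have "(\<lambda>n. integral\<^sup>L lebesgue (?s n)) \<longlonglongrightarrow> (LINT x|lebesgue. indicator (box p q) x *\<^sub>R g x)"
  proof (rule integral_dominated_convergence)
    show m: "(\<lambda>x. indicator (box p q) x *\<^sub>R g x) \<in> borel_measurable lebesgue"
      using i by (rule borel_measurable_integrable)
    have "box_bump n p q \<in> borel_measurable lebesgue" for n
      using test_functions_measurable[OF box_bump_test_functions[OF pq]]
      by (intro measurable_completion) auto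
    then show "?s n \<in> borel_measurable lebesgue" for n
      by (intro borel_measurable_times m)
    show "integrable lebesgue (\<lambda>x. norm (indicator (box p q) x *\<^sub>R g x))" using i by (rule integrable_norm)
    show "AE x in lebesgue. (\<lambda>n. ?s n x) \<longlonglongrightarrow> indicator (box p q) x *\<^sub>R g x"
    proof (rule AE_I2)
      fix x
      have "(\<lambda>n. ?s n x) \<longlonglongrightarrow> (indicator (box p q) x *\<^sub>R g x) * indicator (box p q) x"
        by (intro tendsto_intros box_bump_tendsto)
      then show "(\<lambda>n. ?s n x) \<longlonglongrightarrow> indicator (box p q) x *\<^sub>R g x"
        by (cases "x \<in> box p q") auto
    qed
    show "AE x in lebesgue. norm (?s n x) \<le> norm (indicator (box p q) x *\<^sub>R g x)" for n
    proof (rule AE_I2)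
      fix x
      have "norm (indicator (box p q) x *\<^sub>R g x) * norm (box_bump n p q x) \<le> norm (indicator (box p q) x *\<^sub>R g x)"
        by (intro mult_left_le norm_box_bump_le norm_ge_zero)
      then show "norm (?s n x) \<le> norm (indicator (box p q) x *\<^sub>R g x)" by (simp only: norm_mult)
    qed
  qed
  moreover have "integral\<^sup>L lebesgue (?s n) = 0" for n
  proof -
    have "?s n = (\<lambda>x. indicator \<Omega> x *\<^sub>R (g x * box_bump n p q x))"
      using box_bump_nonzero_iff[of n p q] sub by (fastforce simp: indicator_def)
    then show ?thesis
      using orth[OF box_bump_test_functions[OF pq], of n] \<Omega> by (simp add: integral_restrict_space)
  qed
  ultimately show ?thesis by (simp add: LIMSEQ_const_iff)
qed

text \<open>The integral of \<open>g\<close> over a box is the limit of its integrals against the bump functions of that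
  box, and boxes generate the Borel sets.\<close>

lemma AE_zero_if_orthogonal_test_functions:
  fixes g :: "'a::euclidean_space \<Rightarrow> complex"
  assumes \<Omega>: "open \<Omega>" and g: "g \<in> L2 \<Omega>"
    and orth: "\<And>\<phi>. \<phi> \<in> test_functions \<Omega> \<Longrightarrow> (LINT x|lebesgue_on \<Omega>. g x * \<phi> x) = 0"
  shows "AE x in lebesgue_on \<Omega>. g x = 0"
proof -
  \<comment> \<open>Cutting \<open>g\<close> off to a box yields a function integrable on the whole
    space, as the Dynkin argument requires.\<close>
  have loc: "AE x in lebesgue. x \<in> cbox p q \<longrightarrow> g x = 0" if pq: "cbox p q \<subseteq> \<Omega>" for p q
  proof -
    define f where "f x = indicator (box p q) x *\<^sub>R g x" for x
    have i: "integrable lebesgue f"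
      unfolding f_def using L2_integrable_on_box[OF \<Omega> g] pq box_subset_cbox by blast
    have box: "(LINT x:box a c|lebesgue. f x) = 0" for a c
    proof -
      obtain a' c' where a'c': "box a c \<inter> box p q = box a' c'" by (simp add: box_Int_box)
      have "(LINT x|lebesgue. indicator (box a' c') x *\<^sub>R g x) = 0"
      \<comment> \<open>Only for a nonempty open box is the closed box its closure; a degenerate
        \<open>cbox a' c'\<close> might leave \<Omega>.\<close>
      proof (cases "box a' c' = {}")
        case False
        then have "cbox a' c' \<subseteq> closure (box p q)"
          using closure_mono[of "box a' c'" "box p q"] a'c' by (simp flip: closure_box) blast
        also have "\<dots> \<subseteq> \<Omega>"
          using pq closure_minimal[OF box_subset_cbox closed_cbox] by blast
        finally show ?thesis by (rule integral_box_eq_0_if_orthogonal[OF \<Omega> g _ orth])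
      qed simp
      moreover have "indicator (box a c) x *\<^sub>R f x = indicator (box a' c') x *\<^sub>R g x" for x
        by (simp add: f_def indicator_inter_arith flip: a'c')
      ultimately show ?thesis by (simp add: set_lebesgue_integral_def)
    qed
    have "integral\<^sup>L lebesgue f = 0"
      unfolding f_def by (rule integral_box_eq_0_if_orthogonal[OF \<Omega> g pq orth])
    then have "AE x in lebesgue. f x = 0"
      by (rule AE_zero_if_integral_box_zero[OF i box])
    \<comment> \<open>The boundary is null, which upgrades the open box to the closed one used in
      the countable cover of \<Omega>.\<close>
    moreover have "AE x in lebesgue. x \<notin> cbox p q - box p q"
      using negligible_frontier_interval[of p q] by (intro AE_not_in) (simp add: negligible_iff_null_sets)
    ultimately show ?thesis
      by eventually_elim (auto simp: f_def)
  qed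
  obtain \<D> where \<D>: "countable \<D>" "\<D> \<subseteq> Pow \<Omega>" "\<And>X. X \<in> \<D> \<Longrightarrow> \<exists>a b. X = cbox a b" "\<Union>\<D> = \<Omega>"
    using open_countable_Union_open_cbox[OF \<Omega>] by blast
  have "AE x in lebesgue. x \<in> X \<longrightarrow> g x = 0" if "X \<in> \<D>" for X
    using \<D>(2,3) that loc by blast
  then have "AE x in lebesgue. \<forall>X\<in>\<D>. x \<in> X \<longrightarrow> g x = 0"
    unfolding AE_ball_countable[OF \<D>(1)] by blast
  then have "AE x in lebesgue. x \<in> \<Omega> \<longrightarrow> g x = 0"
    by eventually_elim (use \<D>(4) in blast)
  then show ?thesis using \<Omega> by (subst AE_restrict_space_iff) auto
qed

section \<open>The Dirichlet Laplacian on test functions\<close>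

lemma L2_mult_integrable:
  assumes "f \<in> L2 \<Omega>" "g \<in> L2 \<Omega>"
  shows "integrable (lebesgue_on \<Omega>) (\<lambda>x. f x * g x)"
proof (rule Bochner_Integration.integrable_bound)
  show "integrable (lebesgue_on \<Omega>) (\<lambda>x. (cmod (f x))\<^sup>2 + (cmod (g x))\<^sup>2)"
    using assms by (auto simp: L2_def)
  show "(\<lambda>x. f x * g x) \<in> borel_measurable (lebesgue_on \<Omega>)"
    using assms by (auto simp: L2_def)
  have "s * t \<le> s\<^sup>2 + t\<^sup>2" if "0 \<le> s" "0 \<le> t" for s t :: real
    using sum_squares_bound[of s t] mult_nonneg_nonneg[OF that] by linarith
  then show "AE x in lebesgue_on \<Omega>. norm (f x * g x) \<le> norm ((cmod (f x))\<^sup>2 + (cmod (g x))\<^sup>2)"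
    by (intro AE_I2) (simp add: norm_mult)
qed

lemma borel_measurable_cnj [measurable]: "cnj \<in> borel_measurable borel"
  by (intro borel_measurable_continuous_onI continuous_intros)

lemma L2_cnj: "f \<in> L2 \<Omega> \<Longrightarrow> (\<lambda>x. cnj (f x)) \<in> L2 \<Omega>"
  using measurable_compose[OF _ borel_measurable_cnj, of f "lebesgue_on \<Omega>"] by (simp add: L2_def)

lemma L2_diff:
  assumes "f \<in> L2 \<Omega>" "g \<in> L2 \<Omega>"
  shows "(\<lambda>x. f x - g x) \<in> L2 \<Omega>"
proof -
  have [measurable]: "f \<in> borel_measurable (lebesgue_on \<Omega>)" "g \<in> borel_measurable (lebesgue_on \<Omega>)"
    using assms by (auto simp: L2_def)
  have "integrable (lebesgue_on \<Omega>) (\<lambda>x. (cmod (f x - g x))\<^sup>2)"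
  proof (rule Bochner_Integration.integrable_bound)
    show "integrable (lebesgue_on \<Omega>) (\<lambda>x. 2 * (cmod (f x))\<^sup>2 + 2 * (cmod (g x))\<^sup>2)"
      using assms by (auto simp: L2_def)
    have "(cmod (a - b))\<^sup>2 \<le> 2 * (cmod a)\<^sup>2 + 2 * (cmod b)\<^sup>2" for a b :: complex
    proof -
      have "(cmod (a - b))\<^sup>2 \<le> (cmod a + cmod b)\<^sup>2"
        by (intro power_mono norm_triangle_ineq4) auto
      also have "\<dots> \<le> 2 * (cmod a)\<^sup>2 + 2 * (cmod b)\<^sup>2"
        using sum_squares_bound[of "cmod a" "cmod b"] by (simp add: power2_sum)
      finally show ?thesis .
    qed
    then show "AE x in lebesgue_on \<Omega>. norm ((cmod (f x - g x))\<^sup>2) \<le>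
        norm (2 * (cmod (f x))\<^sup>2 + 2 * (cmod (g x))\<^sup>2)"
      by (intro AE_I2) simp
  qed measurable
  then show ?thesis by (simp add: L2_def)
qed

text \<open>The difference of the two candidates is orthogonal to all test functions, so the
  fundamental lemma applies. This makes the arbitrary choice in \<open>weak_deriv\<close>
  harmless.\<close>

lemma weak_deriv_unique:
  assumes "open \<Omega>" "g \<in> L2 \<Omega>" "g' \<in> L2 \<Omega>" "is_weak_deriv \<Omega> b f g" "is_weak_deriv \<Omega> b f g'"
  shows "AE x in lebesgue_on \<Omega>. g x = g' x"
proof -
  have "AE x in lebesgue_on \<Omega>. g x - g' x = 0"
  proof (rule AE_zero_if_orthogonal_test_functions[OF assms(1) L2_diff[OF assms(2,3)]])
    fix \<phi> assume \<phi>: "\<phi> \<in> test_functions \<Omega>"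
    have i: "integrable (lebesgue_on \<Omega>) (\<lambda>x. g x * \<phi> x)" "integrable (lebesgue_on \<Omega>) (\<lambda>x. g' x * \<phi> x)"
      using assms \<phi> by (auto intro: L2_mult_integrable test_functions_L2)
    have "- (LINT x|lebesgue_on \<Omega>. g x * \<phi> x) = - (LINT x|lebesgue_on \<Omega>. g' x * \<phi> x)"
      using assms(4,5) \<phi> unfolding is_weak_deriv_def by metis
    then show "(LINT x|lebesgue_on \<Omega>. (g x - g' x) * \<phi> x) = 0"
      using i by (simp add: left_diff_distrib)
  qed
  then show ?thesis by simp
qed

lemma weak_deriv_W12:
  assumes "f \<in> W12 \<Omega>" "b \<in> Basis"
  shows "weak_deriv \<Omega> b f \<in> L2 \<Omega>" "is_weak_deriv \<Omega> b f (weak_deriv \<Omega> b f)"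
proof -
  have "\<exists>g. g \<in> L2 \<Omega> \<and> is_weak_deriv \<Omega> b f g" using assms by (auto simp: W12_def)
  from someI_ex[OF this] show "weak_deriv \<Omega> b f \<in> L2 \<Omega>" "is_weak_deriv \<Omega> b f (weak_deriv \<Omega> b f)"
    by (auto simp: weak_deriv_def)
qed

lemma test_functions_W12:
  assumes "open \<Omega>" "u \<in> test_functions \<Omega>" shows "u \<in> W12 \<Omega>"
proof -
  have "\<exists>g\<in>L2 \<Omega>. is_weak_deriv \<Omega> b u g" if "b \<in> Basis" for b
    using that assms
    by (intro bexI[of _ "partial_deriv b u"] is_weak_deriv_partial_deriv test_functions_L2
        partial_deriv_test_functions)
  then show ?thesis using test_functions_L2[OF assms] by (simp add: W12_def)
qed

lemma weak_deriv_test_function: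
  assumes "open \<Omega>" "u \<in> test_functions \<Omega>" "b \<in> Basis"
  shows "AE x in lebesgue_on \<Omega>. weak_deriv \<Omega> b u x = partial_deriv b u x"
  by (rule weak_deriv_unique[OF assms(1) weak_deriv_W12(1)
        test_functions_L2[OF assms(1) partial_deriv_test_functions[OF assms(2,3)]]
        weak_deriv_W12(2) is_weak_deriv_partial_deriv[OF assms]])
     (intro test_functions_W12 assms)+

text \<open>The constant sequence \<open>u\<close> approximates itself. Even so, the chosen weak
  derivative of the zero function is zero only almost everywhere, so its norm has to be computed by
  uniqueness.\<close>

lemma test_functions_W12_0:
  assumes "open \<Omega>" "u \<in> test_functions \<Omega>" shows "u \<in> W12_0 \<Omega>"
proof -
  have "L2_nrm \<Omega> (weak_deriv \<Omega> b (\<lambda>x. 0)) = 0" if b: "b \<in> Basis" for b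
  proof -
    have "AE x in lebesgue_on \<Omega>. (cmod (weak_deriv \<Omega> b (\<lambda>x. 0) x))\<^sup>2 = 0"
      using weak_deriv_test_function[OF assms(1) zero_test_functions b] by eventually_elim simp
    then have "(LINT x|lebesgue_on \<Omega>. (cmod (weak_deriv \<Omega> b (\<lambda>x. 0) x))\<^sup>2) = 0"
      by (rule integral_eq_zero_AE)
    then show ?thesis by (simp add: L2_nrm_def)
  qed
  then have "W12_nrm \<Omega> (\<lambda>x. u x - u x) = 0" by (simp add: W12_nrm_def L2_nrm_def)
  then have "(\<lambda>n::nat. W12_nrm \<Omega> (\<lambda>x. u x - u x)) \<longlonglongrightarrow> 0" by (simp only: tendsto_const)
  then show ?thesis unfolding W12_0_def
    using assms test_functions_W12[OF assms] by (intro CollectI conjI exI[of _ "\<lambda>_. u"]) auto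
qed

section \<open>The classical Laplacian as the action of the Dirichlet operator\<close>

definition laplacian :: "('a::euclidean_space \<Rightarrow> complex) \<Rightarrow> 'a \<Rightarrow> complex" where
  "laplacian u x = (\<Sum>b\<in>Basis. partial_deriv b (partial_deriv b u) x)"

lemma laplacian_test_functions:
  assumes "u \<in> test_functions \<Omega>" shows "laplacian u \<in> test_functions \<Omega>"
  unfolding laplacian_def[abs_def]
  by (rule sum_test_functions[OF finite_Basis])
     (rule partial_deriv_test_functions[OF partial_deriv_test_functions[OF assms]])

text \<open>The derivative is moved off \<open>v\<close> by testing its weak derivative against the
  conjugate of the classical derivative of \<open>u\<close>, which is a test function.\<close>

lemma dirichlet_form_test_function:
  fixes \<Omega> :: "'a::euclidean_space set"
  assumes \<Omega>: "open \<Omega>" and u: "u \<in> test_functions \<Omega>" and v: "v \<in> W12 \<Omega>"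
  shows "dirichlet_form \<Omega> u v = - L2_inner \<Omega> (laplacian u) v"
proof -
  have vL2: "v \<in> L2 \<Omega>" using v by (simp add: W12_def)
  have part: "L2_inner \<Omega> (weak_deriv \<Omega> b u) (weak_deriv \<Omega> b v) =
      - (LINT x|lebesgue_on \<Omega>. partial_deriv b (partial_deriv b u) x * cnj (v x))" if b: "b \<in> Basis" for b
  proof -
    let ?d = "partial_deriv b u" and ?w = "weak_deriv \<Omega> b v"
    have d: "?d \<in> test_functions \<Omega>" by (rule partial_deriv_test_functions[OF u b])
    note w = weak_deriv_W12[OF v b] and wu = weak_deriv_W12[OF test_functions_W12[OF \<Omega> u] b]
    have [measurable]: "?d \<in> borel_measurable (lebesgue_on \<Omega>)" "?w \<in> borel_measurable (lebesgue_on \<Omega>)"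
      "weak_deriv \<Omega> b u \<in> borel_measurable (lebesgue_on \<Omega>)"
      using test_functions_L2[OF \<Omega> d] w(1) wu(1) by (auto simp: L2_def)
    have "L2_inner \<Omega> (weak_deriv \<Omega> b u) ?w = (LINT x|lebesgue_on \<Omega>. ?d x * cnj (?w x))"
      unfolding L2_inner_def
    proof (rule integral_cong_AE)
      show "AE x in lebesgue_on \<Omega>. weak_deriv \<Omega> b u x * cnj (?w x) = ?d x * cnj (?w x)"
        using weak_deriv_test_function[OF \<Omega> u b] by eventually_elim simp
    qed measurable
    \<comment> \<open>Weak derivatives are defined by a pairing without conjugation, so the inner
      product is first turned into the conjugate of such a pairing.\<close>
    also have "\<dots> = (LINT x|lebesgue_on \<Omega>. cnj (?w x * cnj (?d x)))" by (simp add: mult.commute)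
    also have "\<dots> = cnj (LINT x|lebesgue_on \<Omega>. ?w x * cnj (?d x))" by (rule Bochner_Integration.integral_cnj)
    also have "(LINT x|lebesgue_on \<Omega>. ?w x * cnj (?d x)) =
        - (LINT x|lebesgue_on \<Omega>. v x * partial_deriv b (\<lambda>x. cnj (?d x)) x)"
      using w(2) cnj_test_functions[OF d] unfolding is_weak_deriv_def by simp
    also have "partial_deriv b (\<lambda>x. cnj (?d x)) = (\<lambda>x. cnj (partial_deriv b ?d x))"
      by (intro ext partial_deriv_cnj test_functions_differentiable[OF d])
    also have "cnj (- (LINT x|lebesgue_on \<Omega>. v x * cnj (partial_deriv b ?d x))) =
        - (LINT x|lebesgue_on \<Omega>. cnj (v x * cnj (partial_deriv b ?d x)))" 
      by (simp only: complex_cnj_minus Bochner_Integration.integral_cnj[symmetric])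
    finally show ?thesis by (simp add: mult.commute)
  qed
  have "dirichlet_form \<Omega> u v =
      - (\<Sum>b\<in>Basis. LINT x|lebesgue_on \<Omega>. partial_deriv b (partial_deriv b u) x * cnj (v x))"
    by (simp add: dirichlet_form_def part sum_negf)
  also have "\<dots> = - (LINT x|lebesgue_on \<Omega>. (\<Sum>b\<in>Basis. partial_deriv b (partial_deriv b u) x * cnj (v x)))"
    using u by (subst Bochner_Integration.integral_sum)
      (auto intro!: L2_mult_integrable test_functions_L2[OF \<Omega>] partial_deriv_test_functions L2_cnj[OF vL2])
  finally show ?thesis by (simp add: L2_inner_def laplacian_def sum_distrib_right)
qed

lemma test_functions_dirichlet_op:
  assumes \<Omega>: "open \<Omega>" and u: "u \<in> test_functions \<Omega>"
  shows "(u, \<lambda>x. - complex_of_real (h\<^sup>2) * laplacian u x) \<in> dirichlet_op \<Omega> h"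
proof -
  have "(\<lambda>x. - complex_of_real (h\<^sup>2) * laplacian u x) \<in> L2 \<Omega>"
    by (intro test_functions_L2[OF \<Omega>] mult_test_functions laplacian_test_functions[OF u] C_k_const)
  moreover have "complex_of_real (h\<^sup>2) * dirichlet_form \<Omega> u v =
      L2_inner \<Omega> (\<lambda>x. - complex_of_real (h\<^sup>2) * laplacian u x) v" if "v \<in> W12_0 \<Omega>" for v
    using that dirichlet_form_test_function[OF assms, of v]
    by (simp add: W12_0_def L2_inner_def mult.assoc)
  ultimately show ?thesis
    using test_functions_W12_0[OF assms] by (simp add: dirichlet_op_def form_op_def)
qed

lemma test_functions_shifted_schroedinger_op:
  assumes "open \<Omega>" "u \<in> test_functions \<Omega>"
  shows "(u, \<lambda>x. - complex_of_real (h\<^sup>2) * laplacian u x + V x * u x + - lam * u x)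
    \<in> shift_op (schroedinger_op \<Omega> V h) lam"
proof -
  have *: "(u, f) \<in> A \<Longrightarrow> (u, \<lambda>x. f x + W x * u x) \<in> add_mult A W" for f W A
    unfolding add_mult_def by blast
  show ?thesis
    unfolding shift_op_def schroedinger_op_def
    by (rule *[of _ _ "\<lambda>_. - lam"], rule *, rule test_functions_dirichlet_op[OF assms])
qed

section \<open>Quasimodes\<close>

lemma partial_deriv_plane_wave_mult:
  assumes "\<psi> differentiable at x"
  shows "partial_deriv c (\<lambda>x. plane_wave k b x * \<psi> x) x =
    plane_wave k b x * (partial_deriv c \<psi> x + \<i> * complex_of_real (k * (c \<bullet> b)) * \<psi> x)"
  by (subst partial_deriv_mult[OF differentiableI[OF has_derivative_plane_wave] assms])
     (simp add: partial_deriv_plane_wave algebra_simps)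

text \<open>Pulling the plane wave out replaces the derivative along \<open>c\<close> by that
  derivative plus \<open>i k (c . b)\<close>. By orthonormality only the direction \<open>b\<close>
  contributes extra terms to the sum of squares.\<close>

lemma laplacian_plane_wave_mult:
  fixes \<phi> :: "'a::euclidean_space \<Rightarrow> complex"
  assumes \<phi>: "\<phi> \<in> test_functions \<Omega>" and b: "b \<in> Basis"
  shows "laplacian (\<lambda>x. plane_wave k b x * \<phi> x) x = plane_wave k b x *
    (laplacian \<phi> x + 2 * \<i> * complex_of_real k * partial_deriv b \<phi> x - complex_of_real (k\<^sup>2) * \<phi> x)"
proof -
  have second: "partial_deriv c (partial_deriv c (\<lambda>x. plane_wave k b x * \<phi> x)) x =
      plane_wave k b x * (partial_deriv c (partial_deriv c \<phi>) x +
        (if c = b then 2 * \<i> * complex_of_real k * partial_deriv b \<phi> x - complex_of_real (k\<^sup>2) * \<phi> x else 0))"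
    if c: "c \<in> Basis" for c
  proof -
    let ?a = "\<i> * complex_of_real (k * (c \<bullet> b))"
    have d: "\<phi> differentiable at x" "partial_deriv c \<phi> differentiable at x" for x
      using test_functions_differentiable[OF \<phi>]
        test_functions_differentiable[OF partial_deriv_test_functions[OF \<phi> c]] by auto
    have "partial_deriv c (\<lambda>x. plane_wave k b x * \<phi> x) =
        (\<lambda>x. plane_wave k b x * (partial_deriv c \<phi> x + ?a * \<phi> x))"
      by (intro ext partial_deriv_plane_wave_mult d)
    moreover have "partial_deriv c (\<lambda>x. partial_deriv c \<phi> x + ?a * \<phi> x) x =
        partial_deriv c (partial_deriv c \<phi>) x + ?a * partial_deriv c \<phi> x"
      using d by (simp add: partial_deriv_add partial_deriv_mult differentiable_mult)
    moreover have "(\<lambda>x. partial_deriv c \<phi> x + ?a * \<phi> x) differentiable at x"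
      using d by (intro differentiable_add differentiable_mult differentiable_const)
    ultimately have "partial_deriv c (partial_deriv c (\<lambda>x. plane_wave k b x * \<phi> x)) x =
        plane_wave k b x * (partial_deriv c (partial_deriv c \<phi>) x + ?a * partial_deriv c \<phi> x +
          ?a * (partial_deriv c \<phi> x + ?a * \<phi> x))"
      by (simp only: partial_deriv_plane_wave_mult)
    then show ?thesis using b c
      by (cases "c = b") (simp_all add: inner_Basis algebra_simps power2_eq_square)
  qed
  show ?thesis
    unfolding laplacian_def using b
    by (simp add: second sum.distrib flip: sum_distrib_left)
qed

text \<open>The wave number \<open>sqrt t / h\<close> is chosen such that the plane wave contributes exactly \<open>t\<close> to
  the energy.\<close>

lemma quasimode_residual:
  fixes \<phi> :: "'a::euclidean_space \<Rightarrow> complex"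
  assumes \<phi>: "\<phi> \<in> test_functions \<Omega>" and b: "b \<in> Basis" and h: "h > 0" and t: "t \<ge> 0"
  defines "u \<equiv> \<lambda>x. plane_wave (sqrt t / h) b x * \<phi> x"
  shows "- complex_of_real (h\<^sup>2) * laplacian u x + v * u x + - (z + complex_of_real t) * u x =
    plane_wave (sqrt t / h) b x * ((v - z) * \<phi> x - complex_of_real (h\<^sup>2) * laplacian \<phi> x
      - 2 * \<i> * complex_of_real (h * sqrt t) * partial_deriv b \<phi> x)"
proof -
  have "complex_of_real (h\<^sup>2) * complex_of_real ((sqrt t / h)\<^sup>2) = complex_of_real t"
    using h t by (subst of_real_mult[symmetric]) (simp add: power_divide)
  moreover have "complex_of_real (h\<^sup>2) * complex_of_real (sqrt t / h) = complex_of_real (h * sqrt t)"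
    using h by (subst of_real_mult[symmetric]) (simp add: power2_eq_square)
  \<comment> \<open>The computation in letters: \<open>H\<close>, \<open>K\<close>,
    \<open>K2\<close>, \<open>T\<close>, \<open>S\<close> stand for \<open>h\<^sup>2\<close>, the
    wave number, its square, \<open>t\<close> and \<open>h * sqrt t\<close>.\<close>
  moreover have "- H * (p * (L + 2 * \<i> * K * d - K2 * f)) + v * (p * f) + - (z + T) * (p * f) =
      p * ((v - z) * f - H * L - 2 * \<i> * S * d)"
    if "H * K2 = T" "H * K = S" for H p L K d K2 f T S :: complex
    unfolding that[symmetric] by (simp add: algebra_simps)
  ultimately show ?thesis
    unfolding u_def laplacian_plane_wave_mult[OF \<phi> b] by blast
qed

lemma norm_square_sum3_le:
  fixes a b c :: complex
  shows "(cmod (a - b - c))\<^sup>2 \<le> 3 * (cmod a)\<^sup>2 + 3 * (cmod b)\<^sup>2 + 3 * (cmod c)\<^sup>2"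
proof -
  have "cmod (a - b - c) \<le> cmod a + cmod b + cmod c"
    using norm_triangle_ineq4[of "a - b" c] norm_triangle_ineq4[of a b] by linarith
  then have "(cmod (a - b - c))\<^sup>2 \<le> (cmod a + cmod b + cmod c)\<^sup>2"
    by (intro power_mono) auto
  also have "\<dots> \<le> 3 * (cmod a)\<^sup>2 + 3 * (cmod b)\<^sup>2 + 3 * (cmod c)\<^sup>2"
    using sum_squares_bound[of "cmod a" "cmod b"] sum_squares_bound[of "cmod a" "cmod c"]
      sum_squares_bound[of "cmod b" "cmod c"]
    by (simp add: power2_eq_square algebra_simps)
  finally show ?thesis .
qed

text \<open>In the spectrum the right side is infinite; otherwise \<open>(w, u)\<close> belongs to
  the inverse graph and competes in the supremum. Hence it never has to be decided whether
  \<open>lam\<close> is spectral.\<close>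

lemma resolvent_norm_ge:
  assumes "(u, w) \<in> shift_op A lam" "L2_nrm \<Omega> w \<le> 1"
  shows "ereal (L2_nrm \<Omega> u) \<le> resolvent_norm \<Omega> A lam"
  using assms by (auto simp: resolvent_norm_def op_norm_def intro!: Sup_upper)

text \<open>If the norm were zero, the bump would vanish almost everywhere, making a nonempty open
  box negligible.\<close>

lemma L2_nrm_box_bump_pos:
  fixes \<Omega> :: "'a::euclidean_space set"
  assumes "open \<Omega>" "cbox p q \<subseteq> \<Omega>" "box p q \<noteq> {}"
  shows "0 < L2_nrm \<Omega> (box_bump n p q)"
proof -
  let ?f = "box_bump n p q" and ?L = "lebesgue_on \<Omega>"
  have i: "integrable ?L (\<lambda>x. (cmod (?f x))\<^sup>2)"
    using test_functions_L2[OF assms(1) box_bump_test_functions[OF assms(2)]] by (simp add: L2_def)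
  have "(LINT x|?L. (cmod (?f x))\<^sup>2) \<noteq> 0"
  proof
    assume "(LINT x|?L. (cmod (?f x))\<^sup>2) = 0"
    then have "AE x in ?L. (cmod (?f x))\<^sup>2 = 0"
      using integral_nonneg_eq_0_iff_AE[OF i] by simp
    then have "AE x in lebesgue. x \<in> \<Omega> \<longrightarrow> (cmod (?f x))\<^sup>2 = 0"
      using assms(1) by (subst (asm) AE_restrict_space_iff) auto
    then have "AE x in lebesgue. x \<notin> box p q"
      by eventually_elim (use box_bump_nonzero_iff[of n p q] assms(2) box_subset_cbox in force)
    then have "negligible (box p q)"
      by (subst (asm) AE_iff_null_sets[symmetric]) (auto simp: negligible_iff_null_sets)
    then show False using assms(3) by (simp add: negligible_interval)
  qed
  then show ?thesis
    using Bochner_Integration.integral_nonneg[of ?L "\<lambda>x. (cmod (?f x))\<^sup>2"] by (simp add: L2_nrm_def order_less_le)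
qed

lemma test_function_of_norm:
  fixes U \<Omega> :: "'a::euclidean_space set"
  assumes "open \<Omega>" "open U" "U \<subseteq> \<Omega>" "U \<noteq> {}" "0 \<le> R"
  obtains \<phi> where "\<phi> \<in> test_functions \<Omega>" "L2_nrm \<Omega> \<phi> = R" "\<And>x. x \<notin> U \<Longrightarrow> \<phi> x = 0"
proof -
  obtain x0 where "x0 \<in> U" using assms(4) by blast
  then obtain p q where pq: "cbox p q \<subseteq> U" "x0 \<in> box p q"
    using open_contains_cbox[OF assms(2)] by metis
  define n where "n = L2_nrm \<Omega> (box_bump 0 p q)"
  have n: "0 < n" unfolding n_def
    using pq assms(1,3) by (intro L2_nrm_box_bump_pos) auto
  show ?thesis
  proof (rule that[of "\<lambda>x. complex_of_real (R / n) * box_bump 0 p q x"])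
    show "(\<lambda>x. complex_of_real (R / n) * box_bump 0 p q x) \<in> test_functions \<Omega>"
      using pq assms(3) by (intro mult_test_functions C_k_const box_bump_test_functions) auto
    have "L2_nrm \<Omega> (\<lambda>x. complex_of_real (R / n) * box_bump 0 p q x) = R / n * n"
      using n assms(5)
      by (simp add: L2_nrm_def n_def norm_mult norm_divide power_mult_distrib power_divide
          real_sqrt_mult real_sqrt_divide)
    then show "L2_nrm \<Omega> (\<lambda>x. complex_of_real (R / n) * box_bump 0 p q x) = R"
      using n by simp
    show "complex_of_real (R / n) * box_bump 0 p q x = 0" if "x \<notin> U" for x
      using that pq(1) box_bump_nonzero_iff[of 0 p q x] box_subset_cbox[of p q] by auto
  qed
qed

theorem theorem3:
  fixes \<Omega> M :: "'a::euclidean_space set" and V :: "'a \<Rightarrow> complex" and lam :: complex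
  assumes "region \<Omega>"
    and "closed M" and "M \<subseteq> \<Omega>" and "M \<in> null_sets lebesgue"
    and "continuous_on (\<Omega> - M) V" and "bounded (V ` (\<Omega> - M))"
    and "lam \<in> Phi \<Omega> M V"
  shows "((\<lambda>h. resolvent_norm \<Omega> (schroedinger_op \<Omega> V h) lam) \<longlongrightarrow> \<infinity>) (at_right 0)"
  unfolding tendsto_PInfty
proof
  fix r :: real
  \<comment> \<open>The quasimode gets norm \<open>R > r\<close>, while its image under the shifted
    operator gets norm at most 1.\<close>
  define R where "R = max r 0 + 1"
  \<comment> \<open>Chosen so that \<open>3 * \<epsilon>\<^sup>2 * R\<^sup>2\<close> equals 3/4,
    which leaves 1/4 for the terms that vanish with \<open>h\<close>.\<close>
  define \<epsilon> where "\<epsilon> = 1 / (2 * R)"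
  have R: "r < R" "0 < R" by (auto simp: R_def)
  have \<epsilon>: "0 < \<epsilon>" using R by (simp add: \<epsilon>_def)
  have \<Omega>: "open \<Omega>" using assms(1) by (simp add: region_def)
  obtain z t where lam: "lam = z + complex_of_real t" and t: "0 \<le> t"
    and z: "z \<in> closure (V ` (\<Omega> - M))"
    using assms(7) by (auto simp: Phi_def Ran_def)
  define U where "U = (\<Omega> - M) \<inter> V -` ball z \<epsilon>"
  have "open U"
    unfolding U_def using assms(2,5) \<Omega> by (intro continuous_open_preimage) auto
  moreover have "U \<subseteq> \<Omega>" by (auto simp: U_def)
  moreover have "U \<noteq> {}"
  proof -
    obtain y where "y \<in> \<Omega> - M" "dist (V y) z < \<epsilon>"
      using z \<epsilon> by (auto simp: closure_approachable)
    then have "y \<in> U" by (simp add: U_def dist_commute)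
    then show ?thesis by blast
  qed
  ultimately obtain \<phi> where \<phi>: "\<phi> \<in> test_functions \<Omega>" and nrm: "L2_nrm \<Omega> \<phi> = R"
    and out: "\<And>x. x \<notin> U \<Longrightarrow> \<phi> x = 0"
    using test_function_of_norm[OF \<Omega> _ _ _ less_imp_le[OF R(2)], of U] by blast
  obtain b :: 'a where b: "b \<in> Basis" using nonempty_Basis by blast
  have int: "integrable (lebesgue_on \<Omega>) (\<lambda>x. (cmod (\<psi> x))\<^sup>2)" if "\<psi> \<in> test_functions \<Omega>" for \<psi>
    using test_functions_L2[OF \<Omega> that] by (simp add: L2_def)
  note ints = int[OF \<phi>] int[OF laplacian_test_functions[OF \<phi>]]
    int[OF partial_deriv_test_functions[OF \<phi> b]]
  have sq: "(LINT x|lebesgue_on \<Omega>. (cmod (\<phi> x))\<^sup>2) = R\<^sup>2"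
    using nrm by (auto simp: L2_nrm_def)
  \<comment> \<open>The 3 comes from the bound for the square of a three-term sum, and
    \<open>12 * t\<close> is 3 times the squared modulus of
    \<open>2 * \<i> * sqrt t\<close>.\<close>
  define D where "D x = 3 * (cmod (laplacian \<phi> x))\<^sup>2 + 12 * t * (cmod (partial_deriv b \<phi> x))\<^sup>2" for x
  define E where "E = integral\<^sup>L (lebesgue_on \<Omega>) D"
  have D: "integrable (lebesgue_on \<Omega>) D" unfolding D_def[abs_def] using ints by simp
  have "((\<lambda>h. h\<^sup>2 * E) \<longlongrightarrow> 0\<^sup>2 * E) (at_right (0::real))"
    by (intro tendsto_intros)
  then have "\<forall>\<^sub>F h in at_right 0. h\<^sup>2 * E < 1 / 4"
    by (rule order_tendstoD) simp
  moreover have "\<forall>\<^sub>F h in at_right (0::real). 0 < h \<and> h < 1"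
    using eventually_at_right_real[of 0 1] by simp
  ultimately show "\<forall>\<^sub>F h in at_right 0. ereal r < resolvent_norm \<Omega> (schroedinger_op \<Omega> V h) lam"
  proof eventually_elim
    case (elim h)
    define u where "u = (\<lambda>x. plane_wave (sqrt t / h) b x * \<phi> x)"
    define w where "w = (\<lambda>x. - complex_of_real (h\<^sup>2) * laplacian u x + V x * u x + - lam * u x)"
    have u: "u \<in> test_functions \<Omega>"
      unfolding u_def using C_k_plane_wave \<phi> by (rule mult_test_functions)
    have w_le: "(cmod (w x))\<^sup>2 \<le> 3 * \<epsilon>\<^sup>2 * (cmod (\<phi> x))\<^sup>2 + h\<^sup>2 * D x" for x
    proof -
      have "cmod ((V x - z) * \<phi> x) \<le> \<epsilon> * cmod (\<phi> x)"
      \<comment> \<open>Outside \<open>U\<close>, in particular on \<open>M\<close> where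
        \<open>V\<close> is arbitrary, the factor \<phi> vanishes.\<close>
      proof (cases "x \<in> U")
        case True
        then have "cmod (V x - z) \<le> \<epsilon>" by (simp add: U_def dist_norm norm_minus_commute)
        then show ?thesis by (simp add: norm_mult mult_right_mono)
      qed (simp add: out)
      then have 1: "(cmod ((V x - z) * \<phi> x))\<^sup>2 \<le> \<epsilon>\<^sup>2 * (cmod (\<phi> x))\<^sup>2"
        by (metis norm_ge_zero power_mono power_mult_distrib)
      \<comment> \<open>By \<open>h < 1\<close> one factor \<open>h\<close> is given away, so that
        after squaring both error terms carry the same factor \<open>h\<^sup>2\<close>.\<close>
      have "cmod (complex_of_real (h\<^sup>2) * laplacian \<phi> x) \<le> h * cmod (laplacian \<phi> x)"
        using elim by (simp add: norm_mult norm_power power2_eq_square mult_left_le mult_right_mono)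
      then have 2: "(cmod (complex_of_real (h\<^sup>2) * laplacian \<phi> x))\<^sup>2 \<le> h\<^sup>2 * (cmod (laplacian \<phi> x))\<^sup>2"
        by (metis norm_ge_zero power_mono power_mult_distrib)
      have 3: "(cmod (2 * \<i> * complex_of_real (h * sqrt t) * partial_deriv b \<phi> x))\<^sup>2 =
          h\<^sup>2 * (4 * t * (cmod (partial_deriv b \<phi> x))\<^sup>2)"
        using t by (simp add: norm_mult power_mult_distrib)
      have "cmod (w x) = cmod ((V x - z) * \<phi> x - complex_of_real (h\<^sup>2) * laplacian \<phi> x
          - 2 * \<i> * complex_of_real (h * sqrt t) * partial_deriv b \<phi> x)"
        unfolding w_def lam u_def using quasimode_residual[OF \<phi> b _ t] elim by (simp add: norm_mult)
      then have "(cmod (w x))\<^sup>2 \<le> 3 * (cmod ((V x - z) * \<phi> x))\<^sup>2 +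
          3 * (cmod (complex_of_real (h\<^sup>2) * laplacian \<phi> x))\<^sup>2 +
          3 * (cmod (2 * \<i> * complex_of_real (h * sqrt t) * partial_deriv b \<phi> x))\<^sup>2"
        using norm_square_sum3_le by metis
      also have "\<dots> \<le> 3 * (\<epsilon>\<^sup>2 * (cmod (\<phi> x))\<^sup>2) + 3 * (h\<^sup>2 * (cmod (laplacian \<phi> x))\<^sup>2) +
          3 * (h\<^sup>2 * (4 * t * (cmod (partial_deriv b \<phi> x))\<^sup>2))"
        using 1 2 3 by linarith
      finally show ?thesis by (simp add: D_def algebra_simps)
    qed
    \<comment> \<open>Only the nonnegative majorant has to be integrable: if the left integrand is
      not, its integral is 0 by default and the inequality still holds.\<close>
    have "(LINT x|lebesgue_on \<Omega>. (cmod (w x))\<^sup>2) \<le>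
        (LINT x|lebesgue_on \<Omega>. 3 * \<epsilon>\<^sup>2 * (cmod (\<phi> x))\<^sup>2 + h\<^sup>2 * D x)"
      using ints D w_le order_trans[OF zero_le_power2 w_le] by (intro integral_mono') auto
    also have "\<dots> = 3 * \<epsilon>\<^sup>2 * R\<^sup>2 + h\<^sup>2 * E"
      using ints D by (simp add: sq E_def)
    also have "\<dots> \<le> 1"
      using elim R by (simp add: \<epsilon>_def power_divide power_mult_distrib)
    finally have "L2_nrm \<Omega> w \<le> 1" by (simp add: L2_nrm_def)
    moreover have "(u, w) \<in> shift_op (schroedinger_op \<Omega> V h) lam"
      unfolding w_def by (rule test_functions_shifted_schroedinger_op[OF \<Omega> u])
    ultimately have "ereal (L2_nrm \<Omega> u) \<le> resolvent_norm \<Omega> (schroedinger_op \<Omega> V h) lam"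
      by (intro resolvent_norm_ge)
    \<comment> \<open>The plane wave has modulus 1, so it leaves the norm unchanged.\<close>
    moreover have "L2_nrm \<Omega> u = R"
      using nrm by (simp add: u_def L2_nrm_def norm_mult)
    ultimately show ?case using R(1) by (metis ereal_less_eq(3) less_ereal.simps(1) less_le_trans)
  qed
qed

end
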